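(* We have $$\sum_{k=1}^\infty \frac{(-1)^{k-1}}{k^3 \binom{2k}{k} \binom{3k}{k}} \left( \frac{56k^2-32k+5}{(2k-1)^2} H_{2k-1} + \frac{1}{2k} \right) = \frac{\pi^4}{20}$$ and $$\sum_{k=1}^\infty \frac{(-1)^k \big( (56k^2-32k+5) (H_{3k-1}-\frac{46}{3} H_{2k-1} - H_{k-1}) -12k \big)}{(2k-1)^2 k^3 \binom{2k}{k} \binom{3k}{k}} =\frac{7}{10} \pi^4.$$
   Context: For $n\in\{0,1,2,\ldots\}$, $H_n=\sum_{0<j\le n}\frac1j$ denotes the usual harmonic number (so $H_0=0$). *)

theory Defs
  imports "HOL-Analysis.Analysis"
begin

end

theory Submission
  imports Defs
begin

text \<open>
  Both series are accelerated forms of Euler sums of weight four. The starting point is the weight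
  \<open>(-1)\<^sup>N N!\<^sup>2 / ((n - N) \<dots> (n + N))\<close> that underlies the fast series for \<open>\<zeta>(3)\<close>: passing from \<open>N\<close> to
  \<open>N + 1\<close> changes it, after division by \<open>n\<^sup>2\<close>, by a difference that telescopes in \<open>n\<close>. Summing over
  \<open>n \<ge> 2 N + 1\<close> and letting \<open>N\<close> grow trades the slow sum over \<open>n\<close> at \<open>N = 0\<close> for a sum over \<open>N\<close> of a few
  terms near \<open>n = 2 N + 1\<close>, where the weight is essentially \<open>N!\<^sup>3 / (3 N)!\<close>, the reciprocal of the
  product of the two binomial coefficients.

  The weight may be multiplied by a linear combination \<open>L\<close> of harmonic numbers, as happens when it is
  differentiated with respect to a parameter. The telescoping survives if a companion \<open>K\<close> exists
  that satisfies one linear identity; \<open>accelerated_series\<close> draws the conclusion for any such pair, and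
  no differentiation is involved. Two pairs suffice. The pair in
  \<open>accelerated_middle_harmonic_series\<close> gives the first identity, and the second one is \<open>46/3\<close> times
  the first minus \<open>accelerated_symmetric_series\<close>, term by term.

  At \<open>N = 0\<close> the slow sums are combinations of \<open>\<zeta>(4)\<close> and the sum of \<open>H(n) / n\<^sup>3\<close>, which
  \<open>zeta4_and_Euler_sum\<close> evaluates from \<open>\<zeta>(2) = \<pi>\<^sup>2 / 6\<close> by rearranging double series.
\<close>

section \<open>The Euler sums of weight four\<close>

lemma bij_betw_Suc_pos: "bij_betw Suc UNIV {1..}"
  by (rule bij_betwI[of _ _ _ "\<lambda>n. n - 1"]) auto

lemma has_sum_inverse_squares: "((\<lambda>n. 1 / real n ^ 2) has_sum (pi\<^sup>2 / 6)) {1..}"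
proof -
  have "(\<lambda>n. 1 / (real (Suc n))^2) sums (pi\<^sup>2 / 6)"
    using inverse_squares_sums by (simp add: add_ac)
  hence "((\<lambda>n. 1 / (real (Suc n))^2) has_sum (pi\<^sup>2 / 6)) UNIV"
    by (rule sums_nonneg_imp_has_sum) auto
  thus ?thesis
    using has_sum_reindex_bij_betw[OF bij_betw_Suc_pos, of "\<lambda>n. 1 / real n ^ 2"] by blast
qed

lemma sums_harm_shift: "(\<lambda>n. 1 / real (Suc n) - 1 / real (Suc n + m)) sums harm m"
proof (induction m)
  case 0
  show ?case by (simp add: harm_def)
next
  case (Suc m)
  have "(\<lambda>n. 1 / real (n + m + 1)) \<longlonglongrightarrow> 0"
    using LIMSEQ_ignore_initial_segment[OF lim_inverse_n', of "m + 1"] by (simp add: add_ac)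
  hence "(\<lambda>n. 1 / real (n + m + 1) - 1 / real (Suc n + m + 1)) sums (1 / real (0 + m + 1) - 0)"
    by (rule telescope_sums')
  from sums_add[OF Suc.IH this] show ?case
    by (simp add: harm_Suc add_ac inverse_eq_divide)
qed

lemma has_sum_harm_shift:
  assumes "a \<ge> (1::nat)"
  shows "((\<lambda>b. 1 / (real b * real (a + b))) has_sum (harm a / real a)) {1..}"
proof -
  have "(\<lambda>n. 1 / (real (Suc n) * real (a + Suc n))) sums (harm a / real a)"
  proof -
    have "(1 / real (Suc n) - 1 / real (Suc n + a)) / real a = 1 / (real (Suc n) * real (a + Suc n))" for n
      using assms by (simp add: divide_simps del: of_nat_Suc) (simp add: algebra_simps)
    thus ?thesis using sums_divide[OF sums_harm_shift[of a], of "real a"] by simp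
  qed
  hence "((\<lambda>n. 1 / (real (Suc n) * real (a + Suc n))) has_sum (harm a / real a)) UNIV"
    by (rule sums_nonneg_imp_has_sum) auto
  thus ?thesis
    using has_sum_reindex_bij_betw[OF bij_betw_Suc_pos, of "\<lambda>b. 1 / (real b * real (a + b))"] by blast
qed

text \<open>
  Expanding a product of reciprocals of \<open>x\<close> and \<open>y\<close> into fractions over powers of \<open>x + y\<close> turns
  a double series over pairs into sums over ordered pairs \<open>a < a + b\<close>. This is the shuffle product
  of \<open>\<zeta>(2)\<close> with itself.
\<close>

lemma inverse_squares_partial_fractions:
  assumes "x > 0" "y > (0::real)"
  shows "1 / (x\<^sup>2 * (x + y)\<^sup>2) + 1 / (y\<^sup>2 * (x + y)\<^sup>2) +
           (2 * (1 / (x * (x + y) ^ 3)) + 2 * (1 / (y * (x + y) ^ 3))) = 1 / (x\<^sup>2 * y\<^sup>2)"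
proof -
  define s where "s = x + y"
  have pos: "x > 0" "y > 0" "s > 0" using assms by (auto simp: s_def)
  have "2 * (1 / (x * s ^ 3)) + 2 * (1 / (y * s ^ 3)) = 2 * (x + y) / (x * y * s ^ 3)"
    using pos by (simp add: divide_simps)
  also have "\<dots> = 2 * x * y / (x\<^sup>2 * y\<^sup>2 * s\<^sup>2)"
    using pos unfolding s_def[symmetric] by (simp add: power2_eq_square power3_eq_cube)
  finally have 1: "2 * (1 / (x * s ^ 3)) + 2 * (1 / (y * s ^ 3)) = \<dots>" .
  have "1 / (x\<^sup>2 * s\<^sup>2) + 1 / (y\<^sup>2 * s\<^sup>2) = (x\<^sup>2 + y\<^sup>2) / (x\<^sup>2 * y\<^sup>2 * s\<^sup>2)"
    using pos by (simp add: divide_simps)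
  with 1 have "1 / (x\<^sup>2 * s\<^sup>2) + 1 / (y\<^sup>2 * s\<^sup>2) + (2 * (1 / (x * s ^ 3)) + 2 * (1 / (y * s ^ 3))) =
      (x + y)\<^sup>2 / (x\<^sup>2 * y\<^sup>2 * s\<^sup>2)"
    by (simp add: add_divide_distrib[symmetric] power2_sum)
  thus ?thesis using pos by (simp add: s_def)
qed

lemma inverse_square_product_partial_fractions:
  assumes "x > 0" "y > (0::real)"
  shows "1 / (x\<^sup>2 * (x + y)\<^sup>2) + (1 / (x * (x + y) ^ 3) + 1 / (y * (x + y) ^ 3)) =
           1 / x\<^sup>2 * (1 / (y * (x + y)))"
proof -
  define s where "s = x + y"
  have pos: "x > 0" "y > 0" "s > 0" using assms by (auto simp: s_def)
  have "1 / (x * s ^ 3) + 1 / (y * s ^ 3) = (x + y) / (x * y * s ^ 3)"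
    using pos by (simp add: divide_simps)
  also have "\<dots> = x / (x\<^sup>2 * y * s\<^sup>2)"
    using pos unfolding s_def[symmetric] by (simp add: power2_eq_square power3_eq_cube)
  finally have "1 / (x\<^sup>2 * s\<^sup>2) + (1 / (x * s ^ 3) + 1 / (y * s ^ 3)) = (y + x) / (x\<^sup>2 * y * s\<^sup>2)"
    using pos by (simp add: add_divide_distrib)
  also have "\<dots> = 1 / x\<^sup>2 * (1 / (y * s))"
    using pos unfolding add.commute[of y x] s_def[symmetric] by (simp add: power2_eq_square)
  finally show ?thesis by (simp add: s_def)
qed

lemma has_sum_product_squares:
  "((\<lambda>(a,b). 1 / (real a ^ 2 * real b ^ 2)) has_sum (pi ^ 4 / 36)) ({1..} \<times> {1..})"
proof (rule has_sum_SigmaI)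
  let ?z = "pi\<^sup>2 / 6"
  show inner: "((\<lambda>b. case (a, b) of (a, b) \<Rightarrow> 1 / (real a ^ 2 * real b ^ 2)) has_sum (1 / real a ^ 2 * ?z)) {1..}" for a
    using has_sum_cmult_right[OF has_sum_inverse_squares, of "1 / real a ^ 2"] by simp
  show outer: "((\<lambda>a. 1 / real a ^ 2 * ?z) has_sum (pi ^ 4 / 36)) {1..}"
    using has_sum_cmult_left[OF has_sum_inverse_squares, of ?z]
    by (simp add: power2_eq_square power4_eq_xxxx mult.assoc)
  show "(\<lambda>(a,b). 1 / (real a ^ 2 * real b ^ 2)) summable_on {1..} \<times> {1..}"
    by (rule summable_on_SigmaI[OF inner])
       (use outer in \<open>auto simp: summable_on_def\<close>)
qed

text \<open>
  Every double series that occurs below is dominated by the product series of \<open>\<zeta>(2)\<^sup>2\<close>, so all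
  rearrangements are legitimate.
\<close>

lemma summable_on_pairs:
  assumes "\<And>a b. a \<ge> 1 \<Longrightarrow> b \<ge> 1 \<Longrightarrow> 0 \<le> f a b \<and> f a b \<le> 1 / (real a ^ 2 * real b ^ 2)"
  shows "(\<lambda>(a,b). f a b) summable_on ({1..} \<times> {1..})"
  by (rule summable_on_comparison_test[OF has_sum_imp_summable[OF has_sum_product_squares]])
     (use assms in auto)

text \<open>
  Put \<open>X = \<zeta>(2,2)\<close> and \<open>Y = \<zeta>(3,1)\<close>. Splitting \<open>\<zeta>(2)\<^sup>2\<close> along the diagonal gives
  \<open>\<zeta>(2)\<^sup>2 = 2 X + \<zeta>(4)\<close>; partial fractions give \<open>\<zeta>(2)\<^sup>2 = 2 X + 4 Y\<close>; evaluating the double sum of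
  \<open>1 / (a\<^sup>2 b (a + b))\<close> once by rows and once by partial fractions gives \<open>Y + \<zeta>(4) = X + 2 Y\<close>.
  These three linear equations express \<open>X\<close>, \<open>Y\<close> and \<open>\<zeta>(4)\<close> through \<open>\<zeta>(2)\<^sup>2 = \<pi>\<^sup>4 / 36\<close>.
\<close>

lemma zeta4_and_Euler_sum:
  "((\<lambda>n. 1 / real n ^ 4) has_sum (pi ^ 4 / 90)) {1..}"
  "((\<lambda>n. harm n / real n ^ 3) has_sum (pi ^ 4 / 72)) {1..}"
proof -
  let ?P = "{1..} :: nat set"
  define fX where "fX = (\<lambda>a b. 1 / (real a ^ 2 * real (a + b) ^ 2))"
  define fY where "fY = (\<lambda>a b. 1 / (real a * real (a + b) ^ 3))"
  define X where "X = infsum (\<lambda>(a,b). fX a b) (?P \<times> ?P)"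
  define Y where "Y = infsum (\<lambda>(a,b). fY a b) (?P \<times> ?P)"
  have X: "((\<lambda>(a,b). fX a b) has_sum X) (?P \<times> ?P)"
    unfolding X_def
  proof (rule has_sum_infsum, rule summable_on_pairs)
    fix a b :: nat assume ab: "a \<ge> 1" "b \<ge> 1"
    have "real a ^ 2 * real b ^ 2 \<le> real a ^ 2 * real (a + b) ^ 2"
      by (intro mult_left_mono power_mono) auto
    thus "0 \<le> fX a b \<and> fX a b \<le> 1 / (real a ^ 2 * real b ^ 2)"
      using ab by (auto simp: fX_def intro!: divide_left_mono)
  qed
  have Y: "((\<lambda>(a,b). fY a b) has_sum Y) (?P \<times> ?P)"
    unfolding Y_def
  proof (rule has_sum_infsum, rule summable_on_pairs)
    fix a b :: nat assume ab: "a \<ge> 1" "b \<ge> 1"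
    have "real a ^ 2 * real b ^ 2 = real a * (real a * real b ^ 2)"
      by (simp add: power2_eq_square)
    also have "\<dots> \<le> real a * (real (a + b) * real (a + b) ^ 2)"
      by (intro mult_left_mono mult_mono power_mono) auto
    finally have "real a ^ 2 * real b ^ 2 \<le> real a * real (a + b) ^ 3"
      by (simp add: power3_eq_cube power2_eq_square)
    thus "0 \<le> fY a b \<and> fY a b \<le> 1 / (real a ^ 2 * real b ^ 2)"
      using ab by (auto simp: fY_def intro!: divide_left_mono)
  qed
  have X': "((\<lambda>(a,b). fX b a) has_sum X) (?P \<times> ?P)"
    using X by (subst has_sum_swap) simp
  have Y': "((\<lambda>(a,b). fY b a) has_sum Y) (?P \<times> ?P)"
    using Y by (subst has_sum_swap) simp

  have shuffle: "pi ^ 4 / 36 = X + X + (2 * Y + 2 * Y)"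
  proof -
    have "((\<lambda>p. ((case p of (a,b) \<Rightarrow> fX a b) + (case p of (a,b) \<Rightarrow> fX b a)) +
             (2 * (case p of (a,b) \<Rightarrow> fY a b) + 2 * (case p of (a,b) \<Rightarrow> fY b a)))
           has_sum (X + X + (2 * Y + 2 * Y))) (?P \<times> ?P)"
      by (intro has_sum_add has_sum_cmult_right X X' Y Y')
    also have "?this \<longleftrightarrow> ((\<lambda>(a,b). 1 / (real a ^ 2 * real b ^ 2)) has_sum (X + X + (2 * Y + 2 * Y))) (?P \<times> ?P)"
    proof (rule has_sum_cong)
      fix p :: "nat \<times> nat" assume "p \<in> ?P \<times> ?P"
      then obtain a b where p: "p = (a, b)" "real a > 0" "real b > 0" by force
      from inverse_squares_partial_fractions[OF p(2,3)]
      show "(case p of (a,b) \<Rightarrow> fX a b) + (case p of (a,b) \<Rightarrow> fX b a) +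
             (2 * (case p of (a,b) \<Rightarrow> fY a b) + 2 * (case p of (a,b) \<Rightarrow> fY b a)) =
            (case p of (a,b) \<Rightarrow> 1 / (real a ^ 2 * real b ^ 2))"
        by (simp add: p(1) fX_def fY_def add_ac)
    qed
    finally show ?thesis by (rule has_sum_unique[OF has_sum_product_squares])
  qed

  have harmsum: "((\<lambda>a. harm a / real a ^ 3) has_sum (X + (Y + Y))) ?P"
  proof -
    have "((\<lambda>p. (case p of (a,b) \<Rightarrow> fX a b) +
             ((case p of (a,b) \<Rightarrow> fY a b) + (case p of (a,b) \<Rightarrow> fY b a)))
           has_sum (X + (Y + Y))) (?P \<times> ?P)"
      by (intro has_sum_add X Y Y')
    also have "?this \<longleftrightarrow> ((\<lambda>(a,b). 1 / real a ^ 2 * (1 / (real b * real (a + b)))) has_sum (X + (Y + Y))) (?P \<times> ?P)"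
    proof (rule has_sum_cong)
      fix p :: "nat \<times> nat" assume "p \<in> ?P \<times> ?P"
      then obtain a b where p: "p = (a, b)" "real a > 0" "real b > 0" by force
      from inverse_square_product_partial_fractions[OF p(2,3)]
      show "(case p of (a,b) \<Rightarrow> fX a b) +
             ((case p of (a,b) \<Rightarrow> fY a b) + (case p of (a,b) \<Rightarrow> fY b a)) =
            (case p of (a,b) \<Rightarrow> 1 / real a ^ 2 * (1 / (real b * real (a + b))))"
        by (simp add: p(1) fX_def fY_def add_ac)
    qed
    finally have *: "((\<lambda>(a,b). 1 / real a ^ 2 * (1 / (real b * real (a + b)))) has_sum (X + (Y + Y))) (?P \<times> ?P)" .
    have "((\<lambda>a. 1 / real a ^ 2 * (harm a / real a)) has_sum (X + (Y + Y))) ?P"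
    proof (rule has_sum_SigmaD[OF *])
      fix a :: nat assume "a \<in> ?P"
      hence "a \<ge> 1" by simp
      from has_sum_cmult_right[OF has_sum_harm_shift[OF this], of "1 / real a ^ 2"]
      show "((\<lambda>b. case (a, b) of (a, b) \<Rightarrow> 1 / real a ^ 2 * (1 / (real b * real (a + b))))
              has_sum 1 / real a ^ 2 * (harm a / real a)) ?P"
        by simp
    qed
    thus ?thesis by (simp add: power3_eq_cube power2_eq_square)
  qed

  have harmsum': "((\<lambda>n. harm (n - 1) / real n ^ 3) has_sum Y) ?P"
  proof -
    have "bij_betw (\<lambda>(a,b). (a + b, a)) (?P \<times> ?P) (Sigma ?P (\<lambda>n. {1..<n}))"
      by (rule bij_betwI[of _ _ _ "\<lambda>(n,a). (a, n - a)"]) auto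
    from has_sum_reindex_bij_betw[OF this, of "\<lambda>(n,a). 1 / (real a * real n ^ 3)" Y]
    have *: "((\<lambda>(n,a). 1 / (real a * real n ^ 3)) has_sum Y) (Sigma ?P (\<lambda>n. {1..<n}))"
      using Y by (simp add: fY_def case_prod_unfold)
    show ?thesis
    proof (rule has_sum_SigmaD[OF *])
      fix n :: nat assume "n \<in> ?P"
      hence "{1..<n} = {1..n - 1}" by auto
      hence "(\<Sum>a\<in>{1..<n}. 1 / (real a * real n ^ 3)) = harm (n - 1) / real n ^ 3"
        by (simp add: harm_def sum_divide_distrib divide_simps)
      thus "((\<lambda>a. case (n, a) of (n, a) \<Rightarrow> 1 / (real a * real n ^ 3)) has_sum harm (n - 1) / real n ^ 3) {1..<n}"
        using has_sum_finite[of "{1..<n}" "\<lambda>a. 1 / (real a * real n ^ 3)"] by simp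
    qed
  qed

  have zeta4: "((\<lambda>n. 1 / real n ^ 4) has_sum (X + Y)) ?P"
  proof -
    have "((\<lambda>n. harm n / real n ^ 3 + - 1 * (harm (n - 1) / real n ^ 3))
             has_sum (X + (Y + Y) + - 1 * Y)) ?P"
      by (intro has_sum_add has_sum_cmult_right harmsum harmsum')
    also have "?this \<longleftrightarrow> ((\<lambda>n. 1 / real n ^ 4) has_sum (X + (Y + Y) + - 1 * Y)) ?P"
    proof (rule has_sum_cong)
      fix n :: nat assume "n \<in> ?P"
      then obtain m where "n = Suc m" by (cases n) auto
      thus "harm n / real n ^ 3 + - 1 * (harm (n - 1) / real n ^ 3) = 1 / real n ^ 4"
        by (simp add: harm_Suc divide_simps power3_eq_cube power4_eq_xxxx del: of_nat_Suc)
    qed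
    finally show ?thesis by (simp add: add.commute)
  qed

  have stuffle: "pi ^ 4 / 36 = X + X + (X + Y)"
  proof -
    let ?g = "\<lambda>(a,b). 1 / (real a ^ 2 * real b ^ 2)"
    let ?L = "{(a,b). 1 \<le> a \<and> a < (b::nat)}" and ?U = "{(a,b). 1 \<le> b \<and> b < (a::nat)}"
    let ?D = "(\<lambda>n. (n,n)) ` ?P"
    have "bij_betw (\<lambda>(a,b). (a, a + b)) (?P \<times> ?P) ?L"
      by (rule bij_betwI[of _ _ _ "\<lambda>(a,b). (a, b - a)"]) auto
    from has_sum_reindex_bij_betw[OF this, of ?g X] have L: "(?g has_sum X) ?L"
      using X by (simp add: fX_def case_prod_unfold)
    have "bij_betw (\<lambda>(a,b). (a + b, a)) (?P \<times> ?P) ?U"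
      by (rule bij_betwI[of _ _ _ "\<lambda>(a,b). (b, a - b)"]) auto
    from has_sum_reindex_bij_betw[OF this, of ?g X] have U: "(?g has_sum X) ?U"
      using X by (simp add: fX_def case_prod_unfold mult_ac)
    have "bij_betw (\<lambda>n. (n,n)) ?P ?D"
      by (auto simp: bij_betw_def inj_on_def)
    from has_sum_reindex_bij_betw[OF this, of ?g "X + Y"] have D: "(?g has_sum (X + Y)) ?D"
      using zeta4 by (simp add: power4_eq_xxxx power2_eq_square mult_ac)
    have "(?g has_sum (X + X + (X + Y))) (?L \<union> ?U \<union> ?D)"
      by (intro has_sum_Un_disjoint L U D) auto
    moreover have "?L \<union> ?U \<union> ?D = ?P \<times> ?P" by (auto simp: image_iff)
    ultimately have "(?g has_sum (X + X + (X + Y))) (?P \<times> ?P)" by (simp only:)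
    thus ?thesis by (rule has_sum_unique[OF has_sum_product_squares])
  qed

  have "X + Y = pi ^ 4 / 90" "X + (Y + Y) = pi ^ 4 / 72"
    using shuffle stuffle by linarith+
  thus "((\<lambda>n. 1 / real n ^ 4) has_sum (pi ^ 4 / 90)) {1..}"
    and "((\<lambda>n. harm n / real n ^ 3) has_sum (pi ^ 4 / 72)) {1..}"
    using zeta4 harmsum by (simp_all only:)
qed

lemma sums_zeta4: "(\<lambda>n. 1 / real (Suc n) ^ 4) sums (pi ^ 4 / 90)"
  by (rule has_sum_imp_sums,
      subst has_sum_reindex_bij_betw[OF bij_betw_Suc_pos, of "\<lambda>n. 1 / real n ^ 4"],
      rule zeta4_and_Euler_sum(1))

lemma sums_harm_cubes: "(\<lambda>n. harm (Suc n) / real (Suc n) ^ 3) sums (pi ^ 4 / 72)"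
  by (rule has_sum_imp_sums,
      subst has_sum_reindex_bij_betw[OF bij_betw_Suc_pos, of "\<lambda>n. harm n / real n ^ 3"],
      rule zeta4_and_Euler_sum(2))

section \<open>The Apery weight\<close>

text \<open>
  For \<open>n > N\<close> this is \<open>(-1)\<^sup>N N!\<^sup>2\<close> divided by the product of the integers from \<open>n - N\<close> to \<open>n + N\<close>.
  The factorial form makes both recurrences below immediate; it is meaningful only for \<open>n > N\<close>.
\<close>

definition apery_weight :: "nat \<Rightarrow> nat \<Rightarrow> real" where
  "apery_weight N n = (-1) ^ N * fact N ^ 2 * fact (n - N - 1) / fact (n + N)"

lemma apery_weight_0: "n \<ge> 1 \<Longrightarrow> apery_weight 0 n = 1 / real n"
  by (cases n) (auto simp: apery_weight_def divide_simps)

lemma apery_weight_Suc_left: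
  assumes "n \<ge> N + 2"
  shows "apery_weight (Suc N) n =
           - (real N + 1)\<^sup>2 / ((real n)\<^sup>2 - (real N + 1)\<^sup>2) * apery_weight N n"
proof -
  obtain m where n: "n = N + 2 + m" using assms le_Suc_ex by blast
  have *: "(real n)\<^sup>2 - (real N + 1)\<^sup>2 = (real m + 1) * (2 * real N + real m + 3)"
    unfolding n by (simp add: power2_eq_square algebra_simps)
  have "fact (n + Suc N) = (2 * real N + real m + 3) * fact (n + N)"
    by (simp add: n algebra_simps)
  moreover have "n - N - 1 = Suc m" "n - Suc N - 1 = m" by (simp_all add: n)
  ultimately show ?thesis
    unfolding * apery_weight_def
    by (simp add: divide_simps power2_eq_square) (simp add: algebra_simps)
qed

lemma apery_weight_Suc_right:
  assumes "n \<ge> N + 1"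
  shows "apery_weight N (Suc n) = (real n - real N) / (real n + real N + 1) * apery_weight N n"
proof -
  obtain m where n: "n = N + 1 + m" using assms le_Suc_ex by blast
  have "fact (Suc n + N) = (real n + real N + 1) * fact (n + N)"
    by (simp add: algebra_simps)
  moreover have "n - N - 1 = m" "Suc n - N - 1 = Suc m" "real n - real N = real m + 1"
    by (simp_all add: n)
  ultimately show ?thesis
    unfolding apery_weight_def by (simp add: divide_simps) (simp add: algebra_simps)
qed

text \<open>
  Each step in \<open>N\<close> multiplies the weight by \<open>M\<^sup>2 / (n\<^sup>2 - M\<^sup>2)\<close> with \<open>M = N + 1\<close>, up to sign, which is
  at most \<open>1/3\<close> as long as \<open>n \<ge> 2 M\<close>. This is why the sums over \<open>n \<ge> 2 N + 1\<close> vanish in the limit.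
\<close>

lemma apery_weight_bound:
  assumes "n \<ge> 2 * N + 1"
  shows "\<bar>apery_weight N n\<bar> \<le> (1 / 3) ^ N / real n"
  using assms
proof (induction N)
  case 0
  thus ?case by (simp add: apery_weight_0)
next
  case (Suc N)
  let ?M = "real N + 1"
  have "2 * ?M \<le> real n" using Suc.prems by simp
  hence "(2 * ?M)\<^sup>2 \<le> (real n)\<^sup>2" by (intro power_mono) auto
  hence "2\<^sup>2 * ?M\<^sup>2 \<le> (real n)\<^sup>2" by (simp only: power_mult_distrib)
  hence le: "3 * ?M\<^sup>2 \<le> (real n)\<^sup>2 - ?M\<^sup>2" unfolding power2_eq_square[of 2] by linarith
  have M: "?M\<^sup>2 > 0" by simp
  have D: "(real n)\<^sup>2 - ?M\<^sup>2 > 0" using le M by linarith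
  have "?M\<^sup>2 / ((real n)\<^sup>2 - ?M\<^sup>2) \<le> 1 / 3"
  proof -
    have "A / D \<le> 1 / 3" if "3 * A \<le> D" "D > 0" for A D :: real
      using that by (simp add: field_simps)
    thus ?thesis using le D by blast
  qed
  moreover have "0 \<le> ?M\<^sup>2 / ((real n)\<^sup>2 - ?M\<^sup>2)"
    using le M by (intro divide_nonneg_nonneg) linarith+
  moreover have "\<bar>apery_weight (Suc N) n\<bar> =
      ?M\<^sup>2 / ((real n)\<^sup>2 - ?M\<^sup>2) * \<bar>apery_weight N n\<bar>"
    using apery_weight_Suc_left[of N n] Suc.prems le M by (simp add: abs_mult)
  moreover have "\<bar>apery_weight N n\<bar> \<le> (1 / 3) ^ N / real n" using Suc by simp
  ultimately have "\<bar>apery_weight (Suc N) n\<bar> \<le> 1 / 3 * ((1 / 3) ^ N / real n)"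
    by (simp only:) (intro mult_mono, auto)
  thus ?case by simp
qed

definition accel_coeff :: "nat \<Rightarrow> real" where
  "accel_coeff k = (-1) ^ (k - 1) / (real k ^ 3 * real ((2 * k) choose k) * real ((3 * k) choose k))"

text \<open>
  Along \<open>n = 2 N + 1\<close> the weight is \<open>(-1)\<^sup>N N!\<^sup>3 / (3 N + 1)!\<close>, and \<open>k!\<^sup>3 / (3 k)!\<close> is the reciprocal
  of the product of the two binomial coefficients: the shape of the accelerated series comes from
  starting the sums at this particular \<open>n\<close>.
\<close>

lemma apery_weight_diagonal:
  "4 * apery_weight N (2 * N + 1) = 12 * real (Suc N) * real (3 * N + 2) * accel_coeff (Suc N)"
proof -
  let ?k = "Suc N"
  have "real ((2 * ?k) choose ?k) = fact (2 * ?k) / (fact ?k * fact ?k)"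
    by (subst binomial_fact) (auto simp del: fact_Suc mult_Suc_right simp: mult_2)
  moreover have "real ((3 * ?k) choose ?k) = fact (3 * ?k) / (fact ?k * fact (2 * ?k))"
  proof -
    have "3 * ?k - ?k = 2 * ?k" by simp
    thus ?thesis by (subst binomial_fact) (auto simp del: fact_Suc mult_Suc_right)
  qed
  ultimately have "real ((2 * ?k) choose ?k) * real ((3 * ?k) choose ?k) = fact (3 * ?k) / fact ?k ^ 3"
    by (simp add: power3_eq_cube del: fact_Suc mult_Suc_right)
  hence "accel_coeff ?k = (-1) ^ N * fact ?k ^ 3 / (real ?k ^ 3 * fact (3 * ?k))"
    unfolding accel_coeff_def mult.assoc by (simp del: fact_Suc mult_Suc_right)
  also have "fact ?k ^ 3 = real ?k ^ 3 * fact N ^ 3"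
    by (simp add: power_mult_distrib)
  also have "fact (3 * ?k) = (3 * real ?k) * real (3 * N + 2) * fact (3 * N + 1)"
  proof -
    have "3 * ?k = Suc (Suc (3 * N + 1))" by simp
    thus ?thesis by (simp only: fact_Suc) (simp add: algebra_simps)
  qed
  finally have "accel_coeff ?k = (-1) ^ N * fact N ^ 3 / (3 * real ?k * real (3 * N + 2) * fact (3 * N + 1))"
    by (simp del: of_nat_Suc fact_Suc)
  moreover have cancel: "4 * (c / f) = 12 * a * b * (c / (3 * a * b * f))" if "a > 0" "b > 0"
    for a b c f :: real
    using that by simp
  moreover have "apery_weight N (2 * N + 1) = (-1) ^ N * fact N ^ 3 / fact (3 * N + 1)"
  proof -
    have idx: "2 * N + 1 - N - 1 = N" "2 * N + 1 + N = 3 * N + 1" by auto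
    show ?thesis unfolding apery_weight_def idx by (simp add: power2_eq_square power3_eq_cube)
  qed
  moreover have "real ?k > 0" "real (3 * N + 2) > 0" by simp_all
  ultimately show ?thesis using cancel[of "real ?k" "real (3 * N + 2)"] by metis
qed

section \<open>Acceleration by telescoping\<close>

text \<open>
  Let \<open>F N n = w N n * L N n / n\<^sup>2\<close> and \<open>G N n = w N n * K N n / (2 M (n - M))\<close> with the weight \<open>w\<close>
  above and \<open>M = N + 1\<close>. After division by the weight, the hypothesis \<open>cert\<close> is exactly the
  telescoping relation \<open>F N n - F (N + 1) n = G N n - G N (n + 1)\<close>. Let \<open>S N\<close> be the sum of \<open>F N n\<close>
  over \<open>n \<ge> 2 N + 1\<close>. Then \<open>S N - S (N + 1)\<close> consists of the two terms of \<open>S N\<close> below the starting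
  point \<open>2 N + 3\<close> of \<open>S (N + 1)\<close>, and of the boundary term \<open>G N (2 N + 3)\<close>; and \<open>S N\<close> tends to \<open>0\<close>.
  Hence these differences add up to \<open>S 0\<close>, which is the sum of \<open>L 0 n / n\<^sup>3\<close>. Linear bounds on \<open>L\<close>
  and \<open>K\<close> are enough for convergence, since the weight is at most \<open>1 / (3\<^sup>N n)\<close> in the relevant range.

  The choice \<open>L = K = 1\<close> yields the series of Amdeberhan and Zeilberger for \<open>\<zeta>(3)\<close>, because
  \<open>12 k (3 k - 1) + 5 (2 k - 1)\<^sup>2 = 56 k\<^sup>2 - 32 k + 5\<close>.
\<close>

lemma accelerated_series:
  fixes L K :: "nat \<Rightarrow> nat \<Rightarrow> real" and B :: real
  assumes cert: "\<And>N n. n \<ge> N + 2 \<Longrightarrow>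
      (((real n)\<^sup>2 - (real N + 1)\<^sup>2) * L N n + (real N + 1)\<^sup>2 * L (Suc N) n) / (real n)\<^sup>2 =
      ((real n + real N + 1) * K N n - (real n - real N - 1) * K N (Suc n)) / (2 * (real N + 1))"
    and L_bound: "\<And>N n. n \<ge> 2 * N + 1 \<Longrightarrow> \<bar>L N n\<bar> \<le> B * real n"
    and K_bound: "\<And>N n. n \<ge> 2 * N + 3 \<Longrightarrow> \<bar>K N n\<bar> \<le> B * real n"
    and start: "(\<lambda>n. L 0 (Suc n) / real (Suc n) ^ 3) sums s"
  shows "(\<lambda>N. let k = real N + 1 in accel_coeff (Suc N) *
            (12 * k * (3 * k - 1) / (2 * k - 1)\<^sup>2 * L N (2 * N + 1)
              + 3 * L N (2 * N + 2) + 2 * K N (2 * N + 3))) sums (4 * s)"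
proof -
  define F where "F = (\<lambda>N n. apery_weight N n * L N n / (real n)\<^sup>2)"
  define G where "G = (\<lambda>N n. apery_weight N n * K N n / (2 * (real N + 1) * (real n - real N - 1)))"
  define S where "S = (\<lambda>N. \<Sum>m. F N (m + (2 * N + 1)))"
  have B_nonneg: "B \<ge> 0" using L_bound[of 0 1] by simp

  have telescope: "F N n - F (Suc N) n = G N n - G N (Suc n)" if "n \<ge> N + 2" for N n
  proof -
    let ?M = "real N + 1" and ?n = "real n" and ?w = "apery_weight N n"
    have pos: "?n > 0" "?n - ?M > 0" "?n + ?M > 0" "?M > 0" using that by simp_all
    have nz: "?n\<^sup>2 - ?M\<^sup>2 \<noteq> 0"
      using pos by (simp add: square_diff_square_factored power2_eq_square)
    have "F N n - F (Suc N) n = ?w / (?n\<^sup>2 - ?M\<^sup>2) *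
            (((?n\<^sup>2 - ?M\<^sup>2) * L N n + ?M\<^sup>2 * L (Suc N) n) / ?n\<^sup>2)"
      unfolding F_def apery_weight_Suc_left[OF that] using pos nz
      by (simp add: divide_simps) (simp add: algebra_simps)
    also have "\<dots> = ?w / ((?n - ?M) * (?n + ?M)) *
            (((?n + ?M) * K N n - (?n - ?M) * K N (Suc n)) / (2 * ?M))"
      unfolding power2_eq_square[of ?n] power2_eq_square[of ?M]
      using cert[OF that]
      by (simp add: square_diff_square_factored power2_eq_square mult_ac add_ac diff_diff_eq)
    also have "\<dots> = G N n - G N (Suc n)"
    proof -
      have "apery_weight N (Suc n) = (?n - ?M + 1) / (?n + ?M) * ?w"
        using that by (subst apery_weight_Suc_right) (auto simp: algebra_simps)
      moreover have "real (Suc n) - real N - 1 = ?n - ?M + 1" "?n - real N - 1 = ?n - ?M" by auto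
      moreover have "?n - ?M + 1 > 0" using pos by linarith
      ultimately show ?thesis
        unfolding G_def using pos
        by (simp only: ) (simp add: divide_simps, simp add: algebra_simps)
    qed
    finally show ?thesis .
  qed

  have F_bound: "\<bar>F N (m + (2 * N + 1))\<bar> \<le> (1 / 3) ^ N * B * (1 / (real m + 1)\<^sup>2)" for N m
  proof -
    define n where "n = m + (2 * N + 1)"
    have n: "n \<ge> 2 * N + 1" "real n \<ge> real m + 1" "real n > 0" by (simp_all add: n_def)
    have "\<bar>F N n\<bar> = \<bar>apery_weight N n\<bar> * \<bar>L N n\<bar> / (real n)\<^sup>2"
      by (simp add: F_def abs_mult)
    also have "\<dots> \<le> ((1 / 3) ^ N / real n) * (B * real n) / (real n)\<^sup>2"
      using n by (intro divide_right_mono mult_mono apery_weight_bound L_bound) auto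
    also have "\<dots> = (1 / 3) ^ N * B * (1 / (real n)\<^sup>2)" using n by simp
    also have "\<dots> \<le> (1 / 3) ^ N * B * (1 / (real m + 1)\<^sup>2)"
      using n B_nonneg by (intro mult_left_mono divide_left_mono power_mono mult_pos_pos) auto
    finally show ?thesis by (simp add: n_def)
  qed
  have sq: "summable (\<lambda>m. 1 / (real m + 1)\<^sup>2)"
    using inverse_squares_sums by (simp add: sums_iff add_ac)
  have F_summable: "summable (\<lambda>m. F N (m + (2 * N + 1)))" for N
    by (rule summable_comparison_test'[OF summable_mult[OF sq], of 0 _ "(1 / 3) ^ N * B"])
       (use F_bound in auto)

  have G_tendsto: "(\<lambda>m. G N (m + (2 * N + 3))) \<longlonglongrightarrow> 0" for N
  proof (rule Lim_null_comparison)
    show "\<forall>\<^sub>F m in sequentially. norm (G N (m + (2 * N + 3))) \<le> B / real (Suc m)"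
    proof (intro always_eventually allI)
      fix m
      define n where "n = m + (2 * N + 3)"
      have n: "n \<ge> 2 * N + 3" "n \<ge> 2 * N + 1" "real n > 0" by (simp_all add: n_def)
      have pos: "real n - real N - 1 > 0" by (simp add: n_def)
      have d: "2 * (real N + 1) * (real n - real N - 1) \<ge> 1 * real (Suc m)"
        by (intro mult_mono) (auto simp: n_def)
      have "\<bar>G N n\<bar> = \<bar>apery_weight N n\<bar> * \<bar>K N n\<bar> / (2 * (real N + 1) * (real n - real N - 1))"
        using pos by (simp add: G_def abs_mult)
      also have "\<dots> \<le> (1 / real n) * (B * real n) / (1 * real (Suc m))"
      proof (rule frac_le)
        have "(1 / 3) ^ N / real n \<le> 1 / real n"
          using n by (intro divide_right_mono power_le_one) auto
        hence "\<bar>apery_weight N n\<bar> \<le> 1 / real n"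
          using apery_weight_bound[OF n(2)] by linarith
        thus "\<bar>apery_weight N n\<bar> * \<bar>K N n\<bar> \<le> (1 / real n) * (B * real n)"
          using K_bound[OF n(1)] by (intro mult_mono) auto
        show "1 * real (Suc m) \<le> 2 * (real N + 1) * (real n - real N - 1)" by (rule d)
      qed (use B_nonneg in auto)
      also have "\<dots> = B / real (Suc m)" using n by simp
      finally show "norm (G N (m + (2 * N + 3))) \<le> B / real (Suc m)" by (simp add: n_def)
    qed
    show "(\<lambda>m. B / real (Suc m)) \<longlonglongrightarrow> 0"
      using tendsto_mult[OF tendsto_const[of B] LIMSEQ_inverse_real_of_nat]
      by (simp add: field_simps)
  qed

  have step: "S N - S (Suc N) = F N (2 * N + 1) + F N (2 * N + 2) + G N (2 * N + 3)" for N
  proof -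
    have "(\<lambda>m. G N (m + (2 * N + 3)) - G N (Suc m + (2 * N + 3))) sums (G N (0 + (2 * N + 3)) - 0)"
      by (rule telescope_sums'[OF G_tendsto])
    also have "(\<lambda>m. G N (m + (2 * N + 3)) - G N (Suc m + (2 * N + 3))) =
               (\<lambda>m. F N (m + 2 + (2 * N + 1)) - F (Suc N) (m + (2 * Suc N + 1)))"
    proof
      fix m
      show "G N (m + (2 * N + 3)) - G N (Suc m + (2 * N + 3)) =
            F N (m + 2 + (2 * N + 1)) - F (Suc N) (m + (2 * Suc N + 1))"
        using telescope[of N "m + (2 * N + 3)"] by (simp add: numeral_eq_Suc)
    qed
    finally have 1: "\<dots> sums G N (2 * N + 3)" by simp
    have "summable (\<lambda>m. F N (m + 2 + (2 * N + 1)))"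
      using summable_ignore_initial_segment[OF F_summable[of N], of 2] by simp
    from sums_diff[OF summable_sums[OF this] summable_sums[OF F_summable[of "Suc N"]]]
    have "G N (2 * N + 3) = (\<Sum>m. F N (m + 2 + (2 * N + 1))) - S (Suc N)"
      unfolding S_def by (rule sums_unique2[OF 1])
    moreover have "S N = (\<Sum>m. F N (m + 2 + (2 * N + 1))) + (\<Sum>i<2. F N (i + (2 * N + 1)))"
      using suminf_split_initial_segment[OF F_summable[of N], of 2] by (simp only: S_def)
    moreover have "{..<2} = {0, 1::nat}" by auto
    ultimately show ?thesis by simp
  qed

  have "S \<longlonglongrightarrow> 0"
  proof (rule Lim_null_comparison)
    define z where "z = (\<Sum>m. 1 / (real m + 1)\<^sup>2)"
    show "\<forall>\<^sub>F N in sequentially. norm (S N) \<le> (1 / 3) ^ N * (B * z)"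
    proof (intro always_eventually allI)
      fix N
      have "norm (S N) \<le> (\<Sum>m. (1 / 3) ^ N * B * (1 / (real m + 1)\<^sup>2))"
        unfolding S_def
        by (rule norm_suminf_le[OF _ summable_mult[OF sq]]) (use F_bound in simp)
      also have "\<dots> = (1 / 3) ^ N * (B * z)"
        using suminf_mult[OF sq, of "(1 / 3) ^ N * B"] by (simp add: z_def mult.assoc)
      finally show "norm (S N) \<le> (1 / 3) ^ N * (B * z)" .
    qed
    show "(\<lambda>N. (1 / 3) ^ N * (B * z)) \<longlonglongrightarrow> 0"
      by (intro tendsto_mult_left_zero LIMSEQ_power_zero) simp
  qed
  from telescope_sums'[OF this]
  have "(\<lambda>N. 4 * (S N - S (Suc N))) sums (4 * (S 0 - 0))" by (rule sums_mult)
  moreover have "S 0 = s"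
  proof -
    have "F 0 (m + (2 * 0 + 1)) = L 0 (Suc m) / real (Suc m) ^ 3" for m
      by (simp add: F_def apery_weight_0 power2_eq_square power3_eq_cube)
    thus ?thesis unfolding S_def using start by (simp add: sums_iff)
  qed
  moreover have "4 * (S N - S (Suc N)) = (let k = real N + 1 in accel_coeff (Suc N) *
            (12 * k * (3 * k - 1) / (2 * k - 1)\<^sup>2 * L N (2 * N + 1)
              + 3 * L N (2 * N + 2) + 2 * K N (2 * N + 3)))" for N
  proof -
    define k where "k = real N + 1"
    have k: "k > 0" "3 * k - 1 > 0" "2 * k - 1 > 0" by (simp_all add: k_def)
    define v where "v = apery_weight N (2 * N + 1)"
    \<comment> \<open>The weights at \<open>n = 2 k\<close> and \<open>n = 2 k + 1\<close> are rational multiples of the one at \<open>n = 2 k - 1\<close>.\<close>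
    have w2: "apery_weight N (2 * N + 2) = k / (3 * k - 1) * v"
      using apery_weight_Suc_right[of N "2 * N + 1"] by (simp add: v_def k_def algebra_simps)
    have w3: "apery_weight N (2 * N + 3) = (k + 1) / (3 * k) * (k / (3 * k - 1) * v)"
      using apery_weight_Suc_right[of N "2 * N + 2"] unfolding w2[symmetric]
      by (simp add: k_def numeral_eq_Suc algebra_simps)
    have v4: "4 * v = 12 * k * (3 * k - 1) * accel_coeff (Suc N)"
      unfolding v_def apery_weight_diagonal by (simp add: k_def algebra_simps)
    have "F N (2 * N + 1) = v * (L N (2 * N + 1) / (2 * k - 1)\<^sup>2)"
      by (simp add: F_def v_def k_def)
    moreover have "F N (2 * N + 2) = v * (L N (2 * N + 2) / (4 * k * (3 * k - 1)))"
    proof -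
      have "real (2 * N + 2) = 2 * k" by (simp add: k_def)
      thus ?thesis unfolding F_def w2 using k by (simp add: power2_eq_square)
    qed
    moreover have "G N (2 * N + 3) = v * (K N (2 * N + 3) / (6 * k * (3 * k - 1)))"
    proof -
      have eqs: "real (2 * N + 3) - real N - 1 = k + 1" "real N + 1 = k" by (simp_all add: k_def)
      show ?thesis unfolding G_def w3 eqs using k by (simp add: divide_simps)
    qed
    ultimately have "4 * (S N - S (Suc N)) = 4 * v * (L N (2 * N + 1) / (2 * k - 1)\<^sup>2 +
        L N (2 * N + 2) / (4 * k * (3 * k - 1)) + K N (2 * N + 3) / (6 * k * (3 * k - 1)))"
      unfolding step by (simp add: algebra_simps)
    also have "\<dots> = accel_coeff (Suc N) * (12 * k * (3 * k - 1) / (2 * k - 1)\<^sup>2 * L N (2 * N + 1)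
        + 3 * L N (2 * N + 2) + 2 * K N (2 * N + 3))"
      unfolding v4 using k by (simp add: divide_simps) (simp add: algebra_simps)
    finally show ?thesis by (simp add: Let_def k_def)
  qed
  ultimately show ?thesis by simp
qed

section \<open>Two families of harmonic factors\<close>

lemma harm_le_of_nat: "harm n \<le> real n"
proof (induction n)
  case (Suc n)
  have "inverse (real (Suc n)) \<le> 1" by (simp add: inverse_eq_divide)
  with Suc.IH show ?case by (simp add: harm_Suc)
qed (simp add: harm_def)

text \<open>
  Up to its sign factor, the weight extends to real \<open>N\<close> by means of the Gamma function, and \<open>L\<close> is
  minus its logarithmic derivative with respect to \<open>N\<close>. The companion \<open>K\<close> comes from summation by
  parts. With \<open>M = N + 1\<close> and \<open>x = H(n - M - 1) + H(n + N) - 2 H(N)\<close>, both sides of the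
  telescoping condition equal \<open>x + 1 / (n + M)\<close>.
\<close>

lemma accelerated_symmetric_series:
  "(\<lambda>N. let k = real N + 1 in accel_coeff (Suc N) *
      ((56 * k\<^sup>2 - 32 * k + 5) / (2 * k - 1)\<^sup>2 * (harm (3 * N + 2) - harm N)
        - 12 * k / (2 * k - 1)\<^sup>2 + 23 / (3 * k))) sums (pi ^ 4 / 15)"
proof -
  define L where "L = (\<lambda>N n. harm (n - N - 1) + harm (n + N) - 2 * harm N :: real)"
  define K where "K = (\<lambda>N n. harm (n - N - 2) + harm (n + N) - 2 * harm N + 1 / (real N + 1))"
  have "(\<lambda>N. let k = real N + 1 in accel_coeff (Suc N) *
            (12 * k * (3 * k - 1) / (2 * k - 1)\<^sup>2 * L N (2 * N + 1)
              + 3 * L N (2 * N + 2) + 2 * K N (2 * N + 3))) sums (4 * (pi ^ 4 / 60))"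
  proof (rule accelerated_series[where B = 6])
    fix N n :: nat assume "n \<ge> N + 2"
    then obtain m where n: "n = N + 2 + m" using le_Suc_ex by blast
    define M where "M = real N + 1"
    define d e where "d = real n - M" and "e = real n + M"
    define x :: real where "x = harm m + harm (n + N) - 2 * harm N"
    have pos: "d > 0" "e > 0" "M > 0" "real n > 0" by (simp_all add: d_def e_def M_def n)
    have de: "(real n)\<^sup>2 - M\<^sup>2 = d * e"
      by (simp add: d_def e_def power2_eq_square algebra_simps)
    have LK: "L N n = x + 1 / d" "L (Suc N) n = x + 1 / e - 2 / M"
         "K N n = x + 1 / M" "K N (Suc n) = x + 1 / d + 1 / e + 1 / M"
      by (simp_all add: L_def K_def x_def d_def e_def M_def n harm_Suc inverse_eq_divide add_ac)
    have "(d * e * L N n + M\<^sup>2 * L (Suc N) n) / (real n)\<^sup>2 = x + 1 / e"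
    proof -
      have "d * e * L N n + M\<^sup>2 * L (Suc N) n = (d * e + M\<^sup>2) * x + (e - 2 * M + M\<^sup>2 / e)"
        unfolding LK using pos by (simp add: algebra_simps power2_eq_square)
      also have "e - 2 * M + M\<^sup>2 / e = (e - M)\<^sup>2 / e"
        using pos by (simp add: divide_simps power2_eq_square) (simp add: algebra_simps)
      also have "e - M = real n" by (simp add: e_def)
      also have "d * e + M\<^sup>2 = (real n)\<^sup>2" using de by simp
      finally show ?thesis using pos by (simp add: add_divide_distrib)
    qed
    moreover have "(e * K N n - d * K N (Suc n)) / (2 * M) = x + 1 / e"
    proof -
      have "e * K N n - d * K N (Suc n) = (e - d) * (x + 1 / M) - 1 - d / e"
        unfolding LK using pos by (simp add: algebra_simps diff_divide_distrib)
      also have "e - d = 2 * M" by (simp add: d_def e_def)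
      also have "2 * M * (x + 1 / M) - 1 - d / e = 2 * M * x + (e - d) / e"
        using pos by (simp add: distrib_left diff_divide_distrib)
      also have "e - d = 2 * M" by (simp add: d_def e_def)
      finally show ?thesis using pos by (simp add: add_divide_distrib)
    qed
    ultimately show "(((real n)\<^sup>2 - (real N + 1)\<^sup>2) * L N n + (real N + 1)\<^sup>2 * L (Suc N) n) / (real n)\<^sup>2 =
        ((real n + real N + 1) * K N n - (real n - real N - 1) * K N (Suc n)) / (2 * (real N + 1))"
      by (simp add: de[symmetric]) (simp add: d_def e_def M_def diff_diff_eq add.assoc)
  next
    fix N n :: nat assume n: "n \<ge> 2 * N + 1"
    have "harm (n - N - 1) \<le> 2 * real n" "harm (n + N) \<le> 2 * real n" "harm N \<le> real n"
      using n by (auto intro!: order_trans[OF harm_le_of_nat])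
    moreover have "harm (n - N - 1) \<ge> (0::real)" "harm (n + N) \<ge> (0::real)" "harm N \<ge> (0::real)"
      by (rule harm_nonneg)+
    ultimately show "\<bar>L N n\<bar> \<le> 6 * real n"
      unfolding L_def by (intro abs_leI; linarith)
  next
    fix N n :: nat assume n: "n \<ge> 2 * N + 3"
    have "harm (n - N - 2) \<le> 2 * real n" "harm (n + N) \<le> 2 * real n" "harm N \<le> real n"
      using n by (auto intro!: order_trans[OF harm_le_of_nat])
    moreover have "harm (n - N - 2) \<ge> (0::real)" "harm (n + N) \<ge> (0::real)" "harm N \<ge> (0::real)"
      by (rule harm_nonneg)+
    moreover have "1 / (real N + 1) \<le> 1" "1 / (real N + 1) \<ge> 0" "real n \<ge> 1" using n by simp_all
    ultimately show "\<bar>K N n\<bar> \<le> 6 * real n"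
      unfolding K_def by (intro abs_leI; linarith)
  next
    have "(\<lambda>n. 2 * (harm (Suc n) / real (Suc n) ^ 3) - 1 / real (Suc n) ^ 4)
            sums (2 * (pi ^ 4 / 72) - pi ^ 4 / 90)"
      by (intro sums_diff sums_mult sums_harm_cubes sums_zeta4)
    moreover have "2 * (harm (Suc n) / real (Suc n) ^ 3) - 1 / real (Suc n) ^ 4 =
                   L 0 (Suc n) / real (Suc n) ^ 3" for n
      by (simp add: L_def harm_Suc harm_expand(1) divide_simps power3_eq_cube power4_eq_xxxx del: of_nat_Suc)
    ultimately show "(\<lambda>n. L 0 (Suc n) / real (Suc n) ^ 3) sums (pi ^ 4 / 60)" by simp
  qed
  also have "(\<lambda>N. let k = real N + 1 in accel_coeff (Suc N) *
            (12 * k * (3 * k - 1) / (2 * k - 1)\<^sup>2 * L N (2 * N + 1)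
              + 3 * L N (2 * N + 2) + 2 * K N (2 * N + 3))) =
      (\<lambda>N. let k = real N + 1 in accel_coeff (Suc N) *
      ((56 * k\<^sup>2 - 32 * k + 5) / (2 * k - 1)\<^sup>2 * (harm (3 * N + 2) - harm N)
        - 12 * k / (2 * k - 1)\<^sup>2 + 23 / (3 * k)))"
  proof
    fix N
    define k where "k = real N + 1"
    define z where "z = harm (3 * N + 2) - (harm N :: real)"
    have k: "k > 0" "3 * k - 1 > 0" "2 * k - 1 > 0" by (simp_all add: k_def)
    have h: "harm (3 * N + 2) = harm (3 * N + 1) + 1 / (3 * k - 1)"
    proof -
      have "3 * N + 2 = Suc (3 * N + 1)" by simp
      thus ?thesis by (simp only: harm_Suc) (simp add: k_def inverse_eq_divide add_ac)
    qed
    have h': "harm (3 * N + 3) = harm (3 * N + 2) + 1 / (3 * k)"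
    proof -
      have "3 * N + 3 = Suc (3 * N + 2)" by simp
      thus ?thesis by (simp only: harm_Suc) (simp add: k_def inverse_eq_divide add_ac)
    qed
    have h'': "harm (Suc N) = harm N + 1 / k"
      by (simp add: harm_Suc k_def inverse_eq_divide add_ac)
    have idx: "2 * N + 1 - N - 1 = N" "2 * N + 2 - N - 1 = Suc N" "2 * N + 3 - N - 2 = Suc N"
         "2 * N + 1 + N = 3 * N + 1" "2 * N + 2 + N = 3 * N + 2" "2 * N + 3 + N = 3 * N + 3" by auto
    have LK: "L N (2 * N + 1) = z - 1 / (3 * k - 1)" "L N (2 * N + 2) = z + 1 / k"
         "K N (2 * N + 3) = z + 1 / k + 1 / (3 * k) + 1 / k"
      unfolding L_def K_def idx z_def h' h'' using h by (simp_all add: k_def[symmetric])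
    have poly: "56 * k\<^sup>2 - 32 * k + 5 = 12 * k * (3 * k - 1) + 5 * (2 * k - 1)\<^sup>2"
      by (simp add: power2_eq_square algebra_simps)
    have "12 * k * (3 * k - 1) / (2 * k - 1)\<^sup>2 * L N (2 * N + 1) =
          12 * k * (3 * k - 1) / (2 * k - 1)\<^sup>2 * z - 12 * k / (2 * k - 1)\<^sup>2"
      unfolding LK using k by (simp add: divide_simps) (simp add: algebra_simps)
    moreover have "3 * L N (2 * N + 2) + 2 * K N (2 * N + 3) = 5 * z + 23 / (3 * k)"
      unfolding LK using k by (simp add: field_simps)
    moreover have "(56 * k\<^sup>2 - 32 * k + 5) / (2 * k - 1)\<^sup>2 * z =
          12 * k * (3 * k - 1) / (2 * k - 1)\<^sup>2 * z + 5 * z"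
      unfolding poly using k by (simp add: add_divide_distrib distrib_right)
    ultimately have "12 * k * (3 * k - 1) / (2 * k - 1)\<^sup>2 * L N (2 * N + 1)
              + 3 * L N (2 * N + 2) + 2 * K N (2 * N + 3) =
          (56 * k\<^sup>2 - 32 * k + 5) / (2 * k - 1)\<^sup>2 * z - 12 * k / (2 * k - 1)\<^sup>2 + 23 / (3 * k)"
      by linarith
    thus "(let k = real N + 1 in accel_coeff (Suc N) *
            (12 * k * (3 * k - 1) / (2 * k - 1)\<^sup>2 * L N (2 * N + 1)
              + 3 * L N (2 * N + 2) + 2 * K N (2 * N + 3))) =
          (let k = real N + 1 in accel_coeff (Suc N) *
            ((56 * k\<^sup>2 - 32 * k + 5) / (2 * k - 1)\<^sup>2 * (harm (3 * N + 2) - harm N)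
              - 12 * k / (2 * k - 1)\<^sup>2 + 23 / (3 * k)))"
      unfolding Let_def k_def[symmetric] z_def by simp
  qed
  finally show ?thesis by simp
qed

text \<open>
  The combination of harmonic numbers is chosen such that \<open>L N n\<close> reduces to \<open>H(2 k - 1)\<close> at both
  \<open>n = 2 k - 1\<close> and \<open>n = 2 k\<close>, where \<open>k = N + 1\<close>. With \<open>x = H(n - 1) - (H(n - M - 1) - H(N)) / 2\<close> and
  \<open>M = N + 1\<close>, both sides of the telescoping condition equal \<open>x + 1 / (2 n)\<close>.
\<close>

lemma accelerated_middle_harmonic_series:
  "(\<lambda>N. let k = real N + 1 in accel_coeff (Suc N) *
      ((56 * k\<^sup>2 - 32 * k + 5) / (2 * k - 1)\<^sup>2 * harm (2 * N + 1) + 1 / (2 * k))) sums (pi ^ 4 / 20)"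
proof -
  define L where "L = (\<lambda>N n. harm n - (harm (n - N - 1) - harm N) / 2 :: real)"
  define K where "K = (\<lambda>N n. harm (n - 1) - (harm (n - N - 2) - harm N) / 2 + 1 / (4 * (real N + 1)))"
  have "(\<lambda>N. let k = real N + 1 in accel_coeff (Suc N) *
            (12 * k * (3 * k - 1) / (2 * k - 1)\<^sup>2 * L N (2 * N + 1)
              + 3 * L N (2 * N + 2) + 2 * K N (2 * N + 3))) sums (4 * (pi ^ 4 / 80))"
  proof (rule accelerated_series[where B = 6])
    fix N n :: nat assume "n \<ge> N + 2"
    then obtain m where n: "n = N + 2 + m" using le_Suc_ex by blast
    define M where "M = real N + 1"
    define r where "r = real n"
    define d e where "d = r - M" and "e = r + M"
    define x :: real where "x = harm (n - 1) - (harm m - harm N) / 2"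
    have pos: "d > 0" "e > 0" "M > 0" "r > 0" by (simp_all add: r_def d_def e_def M_def n)
    have de: "r\<^sup>2 - M\<^sup>2 = d * e"
      by (simp add: d_def e_def power2_eq_square algebra_simps)
    have hn: "harm n = harm (n - 1) + 1 / r"
      by (simp add: r_def n harm_Suc inverse_eq_divide add_ac)
    have "harm (n - N - 1) = harm m + 1 / d" "harm (Suc n - N - 2) = harm m + 1 / d"
         "harm (Suc N) = harm N + 1 / M"
      by (simp_all add: r_def d_def M_def n harm_Suc inverse_eq_divide add_ac)
    moreover have "K N n' = harm (n' - 1) - (harm (n' - N - 2) - harm N) / 2 + 1 / (4 * M)" for n'
      by (simp only: K_def M_def)
    ultimately have LK: "L N n = x + 1 / r - 1 / (2 * d)" "L (Suc N) n = x + 1 / r + 1 / (2 * M)"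
         "K N n = x + 1 / (4 * M)" "K N (Suc n) = x + 1 / r - 1 / (2 * d) + 1 / (4 * M)"
      using hn by (simp_all add: L_def x_def n add_divide_distrib diff_divide_distrib)
    have "(d * e * L N n + M\<^sup>2 * L (Suc N) n) / r\<^sup>2 = x + 1 / (2 * r)"
    proof -
      have "d * e * L N n + M\<^sup>2 * L (Suc N) n = (d * e + M\<^sup>2) * (x + 1 / r) - (e - M) / 2"
        unfolding LK using pos by (simp add: algebra_simps power2_eq_square add_divide_distrib diff_divide_distrib)
      also have "e - M = r" by (simp add: e_def)
      also have "d * e + M\<^sup>2 = r\<^sup>2" using de by simp
      also have "(r\<^sup>2 * (x + 1 / r) - r / 2) / r\<^sup>2 = x + 1 / (2 * r)"
        using pos by (simp add: divide_simps power2_eq_square) (simp add: algebra_simps)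
      finally show ?thesis .
    qed
    moreover have "(e * K N n - d * K N (Suc n)) / (2 * M) = x + 1 / (2 * r)"
    proof -
      have "e * K N n - d * K N (Suc n) = (e - d) * (x + 1 / (4 * M)) + 1 / 2 - d / r"
        unfolding LK using pos by (simp add: algebra_simps diff_divide_distrib)
      also have "e - d = 2 * M" by (simp add: d_def e_def)
      also have "2 * M * (x + 1 / (4 * M)) + 1 / 2 - d / r = 2 * M * x + (r - d) / r"
        using pos by (simp add: distrib_left diff_divide_distrib)
      also have "r - d = M" by (simp add: d_def)
      finally show ?thesis using pos by (simp add: add_divide_distrib)
    qed
    ultimately show "(((real n)\<^sup>2 - (real N + 1)\<^sup>2) * L N n + (real N + 1)\<^sup>2 * L (Suc N) n) / (real n)\<^sup>2 =
        ((real n + real N + 1) * K N n - (real n - real N - 1) * K N (Suc n)) / (2 * (real N + 1))"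
      by (simp add: de[symmetric]) (simp add: r_def d_def e_def M_def diff_diff_eq add.assoc)
  next
    fix N n :: nat assume n: "n \<ge> 2 * N + 1"
    have "harm (n - N - 1) \<le> 2 * real n" "harm (n) \<le> 2 * real n" "harm N \<le> real n"
      using n by (auto intro!: order_trans[OF harm_le_of_nat])
    moreover have "harm (n - N - 1) \<ge> (0::real)" "harm (n) \<ge> (0::real)" "harm N \<ge> (0::real)"
      by (rule harm_nonneg)+
    moreover have "\<bar>a - (b - c) / 2\<bar> \<le> 6 * r"
      if "b \<le> 2 * r" "a \<le> 2 * r" "c \<le> r" "b \<ge> 0" "a \<ge> 0" "c \<ge> 0" for a b c r :: real
      using that by (simp add: abs_le_iff field_simps)
    ultimately show "\<bar>L N n\<bar> \<le> 6 * real n"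
      unfolding L_def by blast
  next
    fix N n :: nat assume n: "n \<ge> 2 * N + 3"
    have "harm (n - N - 2) \<le> 2 * real n" "harm (n - 1) \<le> 2 * real n" "harm N \<le> real n"
      using n by (auto intro!: order_trans[OF harm_le_of_nat])
    moreover have "harm (n - N - 2) \<ge> (0::real)" "harm (n - 1) \<ge> (0::real)" "harm N \<ge> (0::real)"
      by (rule harm_nonneg)+
    moreover have "1 / (4 * (real N + 1)) \<le> 1" "1 / (4 * (real N + 1)) \<ge> 0" "real n \<ge> 1" using n by simp_all
    moreover have "\<bar>a - (b - c) / 2 + d\<bar> \<le> 6 * r"
      if "b \<le> 2 * r" "a \<le> 2 * r" "c \<le> r" "b \<ge> 0" "a \<ge> 0" "c \<ge> 0" "d \<le> 1" "d \<ge> 0" "r \<ge> 1"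
      for a b c d r :: real
      using that by (simp add: abs_le_iff field_simps)
    ultimately show "\<bar>K N n\<bar> \<le> 6 * real n"
      unfolding K_def by blast
  next
    have "(\<lambda>n. 1 / 2 * (harm (Suc n) / real (Suc n) ^ 3) + 1 / 2 * (1 / real (Suc n) ^ 4))
            sums (1 / 2 * (pi ^ 4 / 72) + 1 / 2 * (pi ^ 4 / 90))"
      by (intro sums_add sums_mult sums_harm_cubes sums_zeta4)
    moreover have "1 / 2 * (harm (Suc n) / real (Suc n) ^ 3) + 1 / 2 * (1 / real (Suc n) ^ 4) =
                   L 0 (Suc n) / real (Suc n) ^ 3" for n
      by (simp add: L_def harm_Suc harm_expand(1) divide_simps power3_eq_cube power4_eq_xxxx del: of_nat_Suc)
    ultimately show "(\<lambda>n. L 0 (Suc n) / real (Suc n) ^ 3) sums (pi ^ 4 / 80)" by simp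
  qed
  also have "(\<lambda>N. let k = real N + 1 in accel_coeff (Suc N) *
            (12 * k * (3 * k - 1) / (2 * k - 1)\<^sup>2 * L N (2 * N + 1)
              + 3 * L N (2 * N + 2) + 2 * K N (2 * N + 3))) =
      (\<lambda>N. let k = real N + 1 in accel_coeff (Suc N) *
      ((56 * k\<^sup>2 - 32 * k + 5) / (2 * k - 1)\<^sup>2 * harm (2 * N + 1) + 1 / (2 * k)))"
  proof
    fix N
    define k where "k = real N + 1"
    define z where "z = (harm (2 * N + 1) :: real)"
    have k: "k > 0" "2 * k - 1 > 0" by (simp_all add: k_def)
    have h: "harm (2 * N + 2) = z + 1 / (2 * k)"
    proof -
      have "2 * N + 2 = Suc (2 * N + 1)" by simp
      thus ?thesis unfolding z_def
        by (simp only: harm_Suc) (simp add: k_def inverse_eq_divide add_ac)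
    qed
    have h': "harm (Suc N) = harm N + 1 / k"
      by (simp add: harm_Suc k_def inverse_eq_divide add_ac)
    have idx: "2 * N + 1 - N - 1 = N" "2 * N + 2 - N - 1 = Suc N" "2 * N + 3 - N - 2 = Suc N"
         "2 * N + 3 - 1 = 2 * N + 2" by auto
    have LK: "L N (2 * N + 1) = z" "L N (2 * N + 2) = z" "K N (2 * N + 3) = z + 1 / (4 * k)"
      unfolding L_def K_def idx h h' by (simp_all add: z_def k_def[symmetric])
    have poly: "56 * k\<^sup>2 - 32 * k + 5 = 12 * k * (3 * k - 1) + 5 * (2 * k - 1)\<^sup>2"
      by (simp add: power2_eq_square algebra_simps)
    have "12 * k * (3 * k - 1) / (2 * k - 1)\<^sup>2 * L N (2 * N + 1)
              + 3 * L N (2 * N + 2) + 2 * K N (2 * N + 3) =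
          (56 * k\<^sup>2 - 32 * k + 5) / (2 * k - 1)\<^sup>2 * z + 1 / (2 * k)"
      unfolding LK poly using k by (simp add: add_divide_distrib distrib_right)
    thus "(let k = real N + 1 in accel_coeff (Suc N) *
            (12 * k * (3 * k - 1) / (2 * k - 1)\<^sup>2 * L N (2 * N + 1)
              + 3 * L N (2 * N + 2) + 2 * K N (2 * N + 3))) =
          (let k = real N + 1 in accel_coeff (Suc N) *
            ((56 * k\<^sup>2 - 32 * k + 5) / (2 * k - 1)\<^sup>2 * harm (2 * N + 1) + 1 / (2 * k)))"
      unfolding Let_def k_def[symmetric] z_def by simp
  qed
  finally show ?thesis by simp
qed

section \<open>The two series for the fourth power of pi\<close>

theorem theorem1p6:
  shows "((\<lambda>n. let k = Suc n in
            (-1) ^ (k - 1) / (real k ^ 3 * real ((2 * k) choose k) * real ((3 * k) choose k)) *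
            ((56 * real k ^ 2 - 32 * real k + 5) / (2 * real k - 1) ^ 2 * harm (2 * k - 1)
              + 1 / (2 * real k)))
          sums (pi ^ 4 / 20)) \<and>
         ((\<lambda>n. let k = Suc n in
            (-1) ^ k *
            ((56 * real k ^ 2 - 32 * real k + 5) *
               (harm (3 * k - 1) - 46 / 3 * harm (2 * k - 1) - harm (k - 1)) - 12 * real k) /
            ((2 * real k - 1) ^ 2 * real k ^ 3 * real ((2 * k) choose k) * real ((3 * k) choose k)))
          sums (7 / 10 * pi ^ 4))"
proof -
  let ?t1 = "\<lambda>N. let k = real N + 1 in accel_coeff (Suc N) *
      ((56 * k\<^sup>2 - 32 * k + 5) / (2 * k - 1)\<^sup>2 * harm (2 * N + 1) + 1 / (2 * k))"
  let ?t2 = "\<lambda>N. let k = real N + 1 in accel_coeff (Suc N) *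
      ((56 * k\<^sup>2 - 32 * k + 5) / (2 * k - 1)\<^sup>2 * (harm (3 * N + 2) - harm N)
        - 12 * k / (2 * k - 1)\<^sup>2 + 23 / (3 * k))"
  have idx: "2 * Suc n - 1 = 2 * n + 1" "3 * Suc n - 1 = 3 * n + 2" "Suc n - 1 = n"
    "real (Suc n) = real n + 1" for n
    by simp_all
  have first: "?t1 = (\<lambda>n. let k = Suc n in
            (-1) ^ (k - 1) / (real k ^ 3 * real ((2 * k) choose k) * real ((3 * k) choose k)) *
            ((56 * real k ^ 2 - 32 * real k + 5) / (2 * real k - 1) ^ 2 * harm (2 * k - 1)
              + 1 / (2 * real k)))"
    unfolding Let_def accel_coeff_def idx ..
  have "(\<lambda>N. 46 / 3 * ?t1 N - ?t2 N) sums (46 / 3 * (pi ^ 4 / 20) - pi ^ 4 / 15)"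
    by (intro sums_diff sums_mult accelerated_middle_harmonic_series accelerated_symmetric_series)
  \<comment> \<open>The terms \<open>46 / 3 * 1 / (2 k)\<close> and \<open>23 / (3 k)\<close> cancel; of the rational parts only the one with \<open>12 k\<close> survives.\<close>
  moreover have "(\<lambda>N. 46 / 3 * ?t1 N - ?t2 N) = (\<lambda>n. let k = Suc n in
            (-1) ^ k *
            ((56 * real k ^ 2 - 32 * real k + 5) *
               (harm (3 * k - 1) - 46 / 3 * harm (2 * k - 1) - harm (k - 1)) - 12 * real k) /
            ((2 * real k - 1) ^ 2 * real k ^ 3 * real ((2 * k) choose k) * real ((3 * k) choose k)))"
  proof
    fix n
    define k where "k = real n + 1"
    define p where "p = 56 * k\<^sup>2 - 32 * k + 5"
    define u where "u = accel_coeff (Suc n)"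
    define h1 h2 h3 where "h1 = (harm n :: real)" and "h2 = (harm (2 * n + 1) :: real)"
      and "h3 = (harm (3 * n + 2) :: real)"
    have k: "k > 0" "2 * k - 1 > 0" by (simp_all add: k_def)
    have "46 / 3 * (u * (p / (2 * k - 1)\<^sup>2 * h2 + 1 / (2 * k)))
          - u * (p / (2 * k - 1)\<^sup>2 * (h3 - h1) - 12 * k / (2 * k - 1)\<^sup>2 + 23 / (3 * k)) =
          u * (- (p * (h3 - 46 / 3 * h2 - h1) - 12 * k) / (2 * k - 1)\<^sup>2)"
    proof -
      define q where "q = 1 / (2 * k - 1)\<^sup>2"
      have q: "a / (2 * k - 1)\<^sup>2 = a * q" for a by (simp add: q_def)
      define c where "c = 1 / k"
      have c: "1 / (2 * k) = c / 2" "23 / (3 * k) = 23 / 3 * c" by (simp_all add: c_def)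
      show ?thesis unfolding q c by (simp add: algebra_simps)
    qed
    also have "u * (- (p * (h3 - 46 / 3 * h2 - h1) - 12 * k) / (2 * k - 1)\<^sup>2) =
        (-1) ^ Suc n * (p * (h3 - 46 / 3 * h2 - h1) - 12 * k) /
          ((2 * k - 1)\<^sup>2 * k ^ 3 * real ((2 * Suc n) choose Suc n) * real ((3 * Suc n) choose Suc n))"
    proof -
      have "s / (a * b * c) * (- A / q) = (- 1 * s) * A / (q * a * b * c)" for s a b c A q :: real
        by (simp add: mult_ac)
      thus ?thesis
        unfolding u_def accel_coeff_def idx k_def[symmetric] power_Suc .
    qed
    finally show "46 / 3 * ?t1 n - ?t2 n = (let k = Suc n in
            (-1) ^ k *
            ((56 * real k ^ 2 - 32 * real k + 5) *
               (harm (3 * k - 1) - 46 / 3 * harm (2 * k - 1) - harm (k - 1)) - 12 * real k) /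
            ((2 * real k - 1) ^ 2 * real k ^ 3 * real ((2 * k) choose k) * real ((3 * k) choose k)))"
      unfolding Let_def idx k_def[symmetric] p_def u_def h1_def h2_def h3_def .
  qed
  ultimately show ?thesis
    using accelerated_middle_harmonic_series unfolding first by simp
qed

end
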